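(* For any $\varepsilon>0$ and $k\ge2$, the following holds. For $h$ sufficiently large, any $(1+\varepsilon)$-embedding of the complete $k$-ary, height-$h$ tree into $\ell_1^d$ requires $$d\ge\frac{\Omega(h\log k)}{\varepsilon^2\log(1/\varepsilon)}.$$
   Context: The complete $k$-ary tree of height $h$ is the rooted tree in which every internal node has exactly $k$ children and all leaves are at distance $h$ from the root; it is regarded as a metric space on its vertex set with the shortest-path metric where each edge has unit length. $\ell_1^d$ denotes $\mathbb R^d$ equipped with the $\ell_1$ norm. $\Omega(h\log k)$ denotes a quantity that is at least $c\,h\log k$ for some universal constant $c>0$. For a map $f:X\to Y$ between metric spaces $(X,d_X)$ and $(Y,d_Y)$, $\|f\|_{\mathrm{Lip}}=\sup_{x\ne y\in X}\frac{d_Y(f(x),f(y))}{d_X(x,y)}$, and the bi-Lipschitz distortion of $f$ is $\|f\|_{\mathrm{Lip}}\cdot\|f^{-1}\|_{\mathrm{Lip}}$ (with $f^{-1}$ defined on $f(X)$), taken to be infinite if $f$ is not one-to-one. A $D$-embedding is a map with distortion at most $D$.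
   Formalization: The factor log(1/ε) in the denominator is replaced by max(1, log(1/ε)), since the printed bound is undefined at ε = 1 and false with a universal constant as ε approaches 1 from below; for ε ≤ 1/e the bounds agree. *)

theory Defs
  imports "HOL-Analysis.Analysis"
begin

text \<open>
  A vertex of the complete \<open>k\<close>-ary tree of height \<open>h\<close> is encoded by the list of child indices
  on the path that leads to it from the root \<open>[]\<close>.
\<close>

definition tree_verts :: "nat \<Rightarrow> nat \<Rightarrow> nat list set" where
  "tree_verts k h = {v. set v \<subseteq> {..<k} \<and> length v \<le> h}"

definition tree_edges :: "nat \<Rightarrow> nat \<Rightarrow> (nat list \<times> nat list) set" where
  "tree_edges k h =
     {(u, v). u \<in> tree_verts k h \<and> v \<in> tree_verts k h \<and> (\<exists>a. v = u @ [a] \<or> u = v @ [a])}"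

definition graph_dist :: "('a \<times> 'a) set \<Rightarrow> 'a \<Rightarrow> 'a \<Rightarrow> real" where
  "graph_dist E u v = real (LEAST n. (u, v) \<in> E ^^ n)"

abbreviation tree_dist :: "nat \<Rightarrow> nat \<Rightarrow> nat list \<Rightarrow> nat list \<Rightarrow> real" where
  "tree_dist k h \<equiv> graph_dist (tree_edges k h)"

text \<open>
  Vectors are functions that are \<open>undefined\<close> outside \<open>{..<d}\<close>, so that two of them with equal
  coordinates are equal.
\<close>

definition l1_space :: "nat \<Rightarrow> (nat \<Rightarrow> real) set" where
  "l1_space d = {..<d} \<rightarrow>\<^sub>E UNIV"

definition l1_dist :: "nat \<Rightarrow> (nat \<Rightarrow> real) \<Rightarrow> (nat \<Rightarrow> real) \<Rightarrow> real" where
  "l1_dist d x y = (\<Sum>i<d. \<bar>x i - y i\<bar>)"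

definition lip_norm ::
  "'a set \<Rightarrow> ('a \<Rightarrow> 'a \<Rightarrow> real) \<Rightarrow> ('b \<Rightarrow> 'b \<Rightarrow> real) \<Rightarrow> ('a \<Rightarrow> 'b) \<Rightarrow> ennreal" where
  "lip_norm X dX dY f =
     (SUP (x, y) \<in> {(x, y). x \<in> X \<and> y \<in> X \<and> x \<noteq> y}. ennreal (dY (f x) (f y) / dX x y))"

definition distortion ::
  "'a set \<Rightarrow> ('a \<Rightarrow> 'a \<Rightarrow> real) \<Rightarrow> ('b \<Rightarrow> 'b \<Rightarrow> real) \<Rightarrow> ('a \<Rightarrow> 'b) \<Rightarrow> ennreal" where
  "distortion X dX dY f =
     (if inj_on f X then lip_norm X dX dY f * lip_norm (f ` X) dY dX (inv_into X f) else \<infinity>)"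

definition is_embedding ::
  "real \<Rightarrow> 'a set \<Rightarrow> ('a \<Rightarrow> 'a \<Rightarrow> real) \<Rightarrow> 'b set \<Rightarrow> ('b \<Rightarrow> 'b \<Rightarrow> real) \<Rightarrow> ('a \<Rightarrow> 'b) \<Rightarrow> bool" where
  "is_embedding D X dX Y dY f \<longleftrightarrow> f \<in> X \<rightarrow> Y \<and> distortion X dX dY f \<le> ennreal D"

lemma Metric_space_l1: "Metric_space (l1_space d) (l1_dist d)"
proof
  fix x y z :: "nat \<Rightarrow> real"
  show "0 \<le> l1_dist d x y" by (simp add: l1_dist_def sum_nonneg)
  show "l1_dist d x y = l1_dist d y x" by (simp add: l1_dist_def abs_minus_commute)
  show "l1_dist d x z \<le> l1_dist d x y + l1_dist d y z"
    unfolding l1_dist_def sum.distrib [symmetric] by (rule sum_mono) linarith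
  assume "x \<in> l1_space d" "y \<in> l1_space d"
  then show "l1_dist d x y = 0 \<longleftrightarrow> x = y"
    by (auto simp: l1_dist_def l1_space_def sum_nonneg_eq_0_iff intro: PiE_ext)
qed

lemma tree_edges_sym: "sym (tree_edges k h)"
  by (auto simp: tree_edges_def sym_def)

lemma tree_root_path:
  "v \<in> tree_verts k h \<Longrightarrow> ([], v) \<in> tree_edges k h ^^ length v"
proof (induction v rule: rev_induct)
  case (snoc a v)
  then have "v \<in> tree_verts k h" "(v, v @ [a]) \<in> tree_edges k h"
    by (auto simp: tree_verts_def tree_edges_def)
  with snoc.IH show ?case by auto
qed simp

lemma relpow_sym_swap:
  assumes "sym E" shows "(u, v) \<in> E ^^ n \<longleftrightarrow> (v, u) \<in> E ^^ n"
proof -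
  have "(y, x) \<in> E ^^ n" if "(x, y) \<in> E ^^ n" for x y
    using that
  proof (induction n arbitrary: y)
    case (Suc n)
    then obtain z where "(x, z) \<in> E ^^ n" "(z, y) \<in> E" by auto
    with Suc.IH assms show ?case by (meson relpow_Suc_I2 symD)
  qed simp
  then show ?thesis by blast
qed

lemma Metric_space_tree: "Metric_space (tree_verts k h) (tree_dist k h)"
proof
  fix x y z
  show "0 \<le> tree_dist k h x y" by (simp add: graph_dist_def)
  show "tree_dist k h x y = tree_dist k h y x"
    unfolding graph_dist_def using relpow_sym_swap[OF tree_edges_sym] by metis
  have conn: "\<exists>n. (u, v) \<in> tree_edges k h ^^ n"
    if "u \<in> tree_verts k h" "v \<in> tree_verts k h" for u v
  proof -
    have "(u, []) \<in> tree_edges k h ^^ length u"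
      using tree_root_path[OF that(1)] relpow_sym_swap[OF tree_edges_sym] by blast
    with tree_root_path[OF that(2)] show ?thesis by (meson relpow_trans)
  qed
  have least: "(u, v) \<in> tree_edges k h ^^ (LEAST n. (u, v) \<in> tree_edges k h ^^ n)"
    if "u \<in> tree_verts k h" "v \<in> tree_verts k h" for u v
    using conn[OF that] by (rule LeastI_ex)
  show "tree_dist k h x y = 0 \<longleftrightarrow> x = y" if "x \<in> tree_verts k h" "y \<in> tree_verts k h"
  proof
    assume "tree_dist k h x y = 0"
    with least[OF that] show "x = y" by (simp add: graph_dist_def)
  next
    assume "x = y"
    then have "(x, y) \<in> tree_edges k h ^^ 0" by simp
    then have "(LEAST n. (x, y) \<in> tree_edges k h ^^ n) \<le> 0" by (rule Least_le)
    then show "tree_dist k h x y = 0" by (simp add: graph_dist_def)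
  qed
  show "tree_dist k h x z \<le> tree_dist k h x y + tree_dist k h y z"
    if "x \<in> tree_verts k h" "y \<in> tree_verts k h" "z \<in> tree_verts k h"
    unfolding graph_dist_def of_nat_add [symmetric] of_nat_le_iff
    by (rule Least_le) (rule relpow_trans[OF least[OF that(1,2)] least[OF that(2,3)]])
qed

end

theory Submission
  imports Defs
begin

text \<open>
  Let \<open>n = h div 2\<close>. For each of the \<open>k ^ n\<close> vertices \<open>u\<close> of depth \<open>n\<close> take a descendant \<open>u'\<close> at depth
  \<open>2 * n\<close> and the displacement \<open>f u' - f u\<close>, with \<open>f\<close> scaled so that distances are multiplied by a
  factor between 1 and \<open>1 + \<epsilon>\<close>. The displacements have norm between \<open>n\<close> and \<open>(1 + \<epsilon>) * n\<close>, and by the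
  triangle inequality any two of them are at distance at least \<open>2 * (1 - \<epsilon>) * n\<close>
  (\<open>displ_ext_separated\<close>). So the tree contains, in disguise, an almost equidistant set of \<open>k ^ n\<close>
  vectors; large almost equidistant sets of vertices have at most about \<open>k ^ (\<epsilon> * h)\<close> elements, and
  it is the passage to displacements that saves the factor \<open>\<epsilon>\<close>.

  For small \<open>\<epsilon>\<close> it remains to bound the size of an almost equidistant set in \<open>l\<^sub>1\<^sup>d\<close>. Separating
  positive and negative parts and normalizing, one has \<open>N = k ^ n\<close> nearly probability vectors
  on \<open>D = 2 * d\<close> points whose overlaps \<open>\<Sum>i. min (p i) (q i)\<close> are at most \<open>\<delta> = 2 * \<epsilon>\<close>. By averaging, most
  vectors have much of their mass on about \<open>\<delta> * D\<close> coordinates where few others are as large;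
  there they can be rounded to multisets of size about \<open>\<delta> * D\<close> with intersections of size about
  \<open>\<delta>\<^sup>2 * D\<close>. A submultiset slightly larger than that determines the vector, so that \<open>ln N\<close> is at most
  of order \<open>\<delta>\<^sup>2 * D * ln (1 / \<delta>)\<close> (\<open>card_le_of_small_overlap\<close>).

  For \<open>\<epsilon> > 1/64\<close> counting lattice points in a ball suffices (\<open>log_card_level_le_dim\<close>), because then
  the bound \<open>2 * (2 + \<epsilon>)\<close> on \<open>n * ln k / d\<close> that it gives is at most a multiple of \<open>\<epsilon>\<^sup>2\<close>.
\<close>

section \<open>Counting vectors of natural numbers\<close>

lemma exists_le_with_sum:
  fixes a :: "nat \<Rightarrow> nat"
  assumes "s \<le> (\<Sum>i<D. a i)"
  shows "\<exists>b. (\<forall>i<D. b i \<le> a i) \<and> (\<Sum>i<D. b i) = s"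
  using assms
proof (induction D arbitrary: s)
  case (Suc D)
  show ?case
  proof (cases "s \<le> (\<Sum>i<D. a i)")
    case True
    then obtain b where "\<forall>i<D. b i \<le> a i" "(\<Sum>i<D. b i) = s" using Suc.IH by blast
    then show ?thesis by (intro exI[of _ "b(D := 0)"]) (auto simp: less_Suc_eq)
  next
    case False
    then show ?thesis using Suc.prems
      by (intro exI[of _ "a(D := s - (\<Sum>i<D. a i))"]) (auto simp: less_Suc_eq)
  qed
qed simp

lemma sum_list_map_upt_lessThan: "sum_list (map b [0..<D]) = (\<Sum>i<D. b i)"
  by (simp add: interv_sum_list_conv_sum_set_nat atLeast0LessThan)

lemma finite_nat_lists_sum:
  "finite {l :: nat list. length l = D \<and> sum_list l = s}"
proof (rule finite_subset)
  show "{l :: nat list. length l = D \<and> sum_list l = s} \<subseteq> {l. set l \<subseteq> {..s} \<and> length l = D}"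
    using member_le_sum_list by auto
qed (simp add: finite_lists_length_eq)

text \<open>
  Regard \<open>a x\<close> as a multiset of at least \<open>s\<close> elements of \<open>{..<D}\<close>. Choose from each of them a
  submultiset of size \<open>s\<close>. No submultiset is chosen twice, since it would lie in the intersection
  of two of the given multisets, which has fewer than \<open>s\<close> elements. So \<open>G\<close> has at most as many
  elements as there are multisets of size \<open>s\<close> on \<open>D\<close> points.
\<close>

lemma card_le_choose_of_small_overlap:
  fixes a :: "'a \<Rightarrow> nat \<Rightarrow> nat"
  assumes big: "\<And>x. x \<in> G \<Longrightarrow> s \<le> (\<Sum>i<D. a x i)"
    and small: "\<And>x y. x \<in> G \<Longrightarrow> y \<in> G \<Longrightarrow> x \<noteq> y \<Longrightarrow> (\<Sum>i<D. min (a x i) (a y i)) < s"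
  shows "card G \<le> (s + D - 1) choose s"
proof -
  have "\<forall>x\<in>G. \<exists>b. (\<forall>i<D. b i \<le> a x i) \<and> (\<Sum>i<D. b i) = s"
    using exists_le_with_sum big by blast
  then obtain b where b: "\<And>x i. x \<in> G \<Longrightarrow> i < D \<Longrightarrow> b x i \<le> a x i"
    "\<And>x. x \<in> G \<Longrightarrow> (\<Sum>i<D. b x i) = s"
    by metis
  have "inj_on (\<lambda>x. map (b x) [0..<D]) G"
  proof (rule inj_onI, rule ccontr)
    fix x y assume xy: "x \<in> G" "y \<in> G" "map (b x) [0..<D] = map (b y) [0..<D]" "x \<noteq> y"
    then have eq: "b x i = b y i" if "i < D" for i using that by auto
    have "s = (\<Sum>i<D. b x i)" using b(2) xy(1) by simp
    also have "\<dots> \<le> (\<Sum>i<D. min (a x i) (a y i))"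
      using b(1)[OF xy(1)] b(1)[OF xy(2)] eq by (intro sum_mono) auto
    also have "\<dots> < s" using small xy by blast
    finally show False by simp
  qed
  moreover have "(\<lambda>x. map (b x) [0..<D]) ` G \<subseteq> {l. length l = D \<and> sum_list l = s}"
    using b(2) by (auto simp: sum_list_map_upt_lessThan)
  ultimately have "card G \<le> card {l :: nat list. length l = D \<and> sum_list l = s}"
    using finite_nat_lists_sum by (metis card_inj_on_le)
  then show ?thesis by (simp add: card_length_sum_list)
qed

text \<open>
  Appending the slack \<open>S - (\<Sum>i<D. a x i)\<close> as one more entry makes the sums equal to \<open>S\<close>, and
  such vectors are counted by a binomial coefficient.
\<close>

lemma card_le_pow2_of_distinct:
  fixes a :: "'a \<Rightarrow> nat \<Rightarrow> nat"
  assumes bound: "\<And>x. x \<in> G \<Longrightarrow> (\<Sum>i<D. a x i) \<le> S"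
    and distinct: "\<And>x y. x \<in> G \<Longrightarrow> y \<in> G \<Longrightarrow> x \<noteq> y \<Longrightarrow> \<exists>i<D. a x i \<noteq> a y i"
  shows "card G \<le> 2 ^ (D + S)"
proof -
  define c where "c x = map (a x) [0..<D] @ [S - (\<Sum>i<D. a x i)]" for x
  have "inj_on c G"
  proof (rule inj_onI, rule ccontr)
    fix x y assume xy: "x \<in> G" "y \<in> G" "c x = c y" "x \<noteq> y"
    then have "\<forall>i<D. a x i = a y i" by (auto simp: c_def)
    then show False using distinct[OF xy(1,2,4)] by blast
  qed
  moreover have "c ` G \<subseteq> {l. length l = Suc D \<and> sum_list l = S}"
    using bound by (auto simp: c_def sum_list_map_upt_lessThan)
  ultimately have "card G \<le> card {l :: nat list. length l = Suc D \<and> sum_list l = S}"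
    using finite_nat_lists_sum by (metis card_inj_on_le)
  also have "\<dots> = (S + D) choose S" by (simp add: card_length_sum_list)
  also have "\<dots> \<le> 2 ^ (D + S)" by (metis add.commute binomial_le_pow2)
  finally show ?thesis .
qed

lemma choose_le_exp:
  assumes "s > 0"
  shows "real (m choose s) \<le> (exp 1 * real m / real s) ^ s"
proof -
  \<comment> \<open>The bound \<open>s! \<ge> (s / e) ^ s\<close> compares one term of the exponential series with its sum.\<close>
  have "(\<Sum>k\<in>{s}. real s ^ k /\<^sub>R fact k) \<le> exp (real s)"
    unfolding exp_def by (rule sum_le_suminf[OF summable_exp_generic]) auto
  then have e: "real s ^ s \<le> exp (real s) * fact s"
    by (simp add: field_simps)
  have "real (m choose s) * fact s \<le> real m ^ s"
    using binomial_fact_pow[of m s] by (metis of_nat_fact of_nat_le_iff of_nat_mult of_nat_power)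
  then have "real (m choose s) * fact s * real s ^ s \<le> real m ^ s * (exp (real s) * fact s)"
    using e by (intro mult_mono) auto
  then have "real (m choose s) * real s ^ s \<le> real m ^ s * exp (real s)"
    by simp
  moreover have "exp (real s) = exp 1 ^ s" by (simp flip: exp_of_nat_mult)
  ultimately show ?thesis using assms
    by (simp add: power_mult_distrib power_divide field_simps)
qed

section \<open>Packing vectors with small overlaps\<close>

text \<open>
  The largest value of \<open>q\<close> that at least \<open>c\<close> points attain or exceed will do. Values may be
  repeated, hence one strict and one weak inequality.
\<close>

lemma exists_upper_quantile:
  fixes q :: "'a \<Rightarrow> real"
  assumes fin: "finite I" "I \<noteq> {}" and c: "0 \<le> c" "c \<le> real (card I)"
  shows "\<exists>\<theta>. real (card {x \<in> I. q x > \<theta>}) \<le> c \<and> real (card {x \<in> I. q x \<ge> \<theta>}) \<ge> c"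
proof -
  define V where "V = {v \<in> q ` I. real (card {x \<in> I. q x \<ge> v}) \<ge> c}"
  have "{x \<in> I. q x \<ge> Min (q ` I)} = I" using fin by auto
  then have "Min (q ` I) \<in> V" using fin c by (auto simp: V_def)
  moreover have finV: "finite V" using fin by (simp add: V_def)
  ultimately have V: "Max V \<in> V" by (intro Max_in) auto
  have "real (card {x \<in> I. q x > Max V}) \<le> c"
  proof (cases "{x \<in> I. q x > Max V} = {}")
    case False
    define W where "W = q ` {x \<in> I. q x > Max V}"
    have W: "finite W" "W \<noteq> {}" using False fin by (auto simp: W_def)
    then have m: "Min W \<in> W" by simp
    have "{x \<in> I. q x > Max V} = {x \<in> I. q x \<ge> Min W}"
    proof (intro Collect_cong conj_cong refl iffI)
      fix x assume "x \<in> I"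
      then show "q x \<ge> Min W" if "q x > Max V" using that W(1) by (auto simp: W_def)
      show "q x > Max V" if "q x \<ge> Min W" using that m by (auto simp only: W_def)
    qed
    moreover have "Min W \<notin> V" using m Max_ge[OF finV, of "Min W"] by (auto simp: W_def)
    then have "real (card {x \<in> I. q x \<ge> Min W}) < c" using m by (auto simp: V_def W_def)
    ultimately show ?thesis by simp
  next
    case True
    show ?thesis unfolding True using c by simp
  qed
  then show ?thesis using V by (auto simp: V_def)
qed

text \<open>
  The vectors \<open>p x\<close> are almost probability vectors and any two of them have small overlap. A
  coordinate in which many of them are large contributes to many overlaps. So for a typical
  \<open>x\<close> a constant part of the mass of \<open>p x\<close> lies above the thresholds \<open>\<theta> i\<close>, which only a fraction
  \<open>4 * \<delta>\<close> of the vectors exceed; this excess is supported on about \<open>\<delta> * D\<close> coordinates. Rounded to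
  multiples of about \<open>1 / (\<delta> * D)\<close>, it becomes a multiset of size about \<open>\<delta> * D\<close>, and two such
  multisets share only about \<open>\<delta>\<^sup>2 * D\<close> elements. Counting submultisets of that size bounds the
  number of vectors by \<open>(1 / \<delta>) ^ O(\<delta>\<^sup>2 * D)\<close>. The parameter \<open>R\<close> stands for \<open>max 1 (\<delta>\<^sup>2 * D)\<close>; being at
  least 1, it absorbs the rounding of the size \<open>s\<close> of the submultisets to an integer.
\<close>

lemma card_le_of_small_overlap:
  fixes p :: "'a \<Rightarrow> nat \<Rightarrow> real"
  assumes fin: "finite I" and nonneg: "\<And>x i. x \<in> I \<Longrightarrow> i < D \<Longrightarrow> 0 \<le> p x i"
    and mass: "\<And>x. x \<in> I \<Longrightarrow> 7/8 \<le> (\<Sum>i<D. p x i)" "\<And>x. x \<in> I \<Longrightarrow> (\<Sum>i<D. p x i) \<le> 1"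
    and overlap: "\<And>x y. x \<in> I \<Longrightarrow> y \<in> I \<Longrightarrow> x \<noteq> y \<Longrightarrow> (\<Sum>i<D. min (p x i) (p y i)) \<le> \<delta>"
    and \<delta>: "0 < \<delta>" "\<delta> \<le> 1/32" and R: "1 \<le> R" "\<delta>\<^sup>2 * real D \<le> R"
    and many: "1 \<le> \<delta> * real (card I)"
  shows "real (card I) \<le> 16 * exp (51 * R * ln (1 / \<delta>))"
proof -
  define N where "N = real (card I)"
  have N: "N > 0" "1 \<le> \<delta> * N" using many by (cases "card I = 0"; simp add: N_def)+
  then have ne: "I \<noteq> {}" by (auto simp: N_def)
  have level: "0 \<le> 4*\<delta>*N" "4*\<delta>*N \<le> real (card I)"
    using mult_right_mono[of "4*\<delta>" 1 N] \<delta> N(1) by (simp_all add: N_def)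
  have "\<forall>i. \<exists>\<theta>. real (card {x \<in> I. p x i > \<theta>}) \<le> 4*\<delta>*N \<and>
      real (card {x \<in> I. p x i \<ge> \<theta>}) \<ge> 4*\<delta>*N"
    by (intro allI exists_upper_quantile fin ne level)
  from choice[OF this] obtain \<theta>
    where \<theta>: "\<And>i. real (card {x \<in> I. p x i > \<theta> i}) \<le> 4*\<delta>*N"
      "\<And>i. real (card {x \<in> I. p x i \<ge> \<theta> i}) \<ge> 4*\<delta>*N"
    by blast
  define g where "g x i = p x i - min (p x i) (\<theta> i)" for x i
  define A where "A x = {i. i < D \<and> p x i > \<theta> i}" for x
  have g0: "0 \<le> g x i" for x i by (simp add: g_def)
  have gA: "g x i = 0" if "i < D" "i \<notin> A x" for x i using that by (auto simp: g_def A_def)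
  have finA: "finite (A x)" "A x \<subseteq> {..<D}" for x by (auto simp: A_def)
  have \<theta>0: "0 \<le> \<theta> i" if "i < D" for i
  proof (rule ccontr)
    assume neg: "\<not> 0 \<le> \<theta> i"
    then have "{x \<in> I. p x i > \<theta> i} = I" using nonneg[OF _ that] by force
    then have "N \<le> 4*\<delta>*N" using \<theta>(1)[of i] by (simp add: N_def)
    then show False using \<delta> N by simp
  qed
  have gp: "g x i \<le> p x i" if "x \<in> I" "i < D" for x i
    using \<theta>0[OF that(2)] nonneg[OF that] by (simp add: g_def)
  \<comment> \<open>At least a fraction \<open>4 * \<delta>\<close> of the vectors reach the threshold, so whatever mass lies below it
     reappears in that many overlaps.\<close>
  have col: "4*\<delta>*N * (\<Sum>x\<in>I. min (p x i) (\<theta> i)) \<le> (\<Sum>x\<in>I. \<Sum>y\<in>I. min (p x i) (p y i))"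
    if i: "i < D" for i
    unfolding sum_distrib_left
  proof (rule sum_mono)
    fix x assume x: "x \<in> I"
    have "4*\<delta>*N * min (p x i) (\<theta> i) \<le> real (card {y \<in> I. p y i \<ge> \<theta> i}) * min (p x i) (\<theta> i)"
      using \<theta>(2) \<theta>0[OF i] nonneg[OF x i] by (intro mult_right_mono) auto
    also have "\<dots> = (\<Sum>y\<in>{y \<in> I. p y i \<ge> \<theta> i}. min (p x i) (\<theta> i))" by simp
    also have "\<dots> \<le> (\<Sum>y\<in>{y \<in> I. p y i \<ge> \<theta> i}. min (p x i) (p y i))"
      by (intro sum_mono) auto
    also have "\<dots> \<le> (\<Sum>y\<in>I. min (p x i) (p y i))"
      using fin nonneg i x by (intro sum_mono2) auto
    finally show "4*\<delta>*N * min (p x i) (\<theta> i) \<le> (\<Sum>y\<in>I. min (p x i) (p y i))" .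
  qed
  define M where "M = (\<Sum>x\<in>I. \<Sum>i<D. min (p x i) (\<theta> i))"
  have "4*\<delta>*N * M = (\<Sum>i<D. 4*\<delta>*N * (\<Sum>x\<in>I. min (p x i) (\<theta> i)))"
    unfolding M_def sum.swap[of _ "{..<D}" I] by (simp add: sum_distrib_left)
  also have "\<dots> \<le> (\<Sum>i<D. \<Sum>x\<in>I. \<Sum>y\<in>I. min (p x i) (p y i))"
    using col by (intro sum_mono) auto
  also have "\<dots> = (\<Sum>x\<in>I. \<Sum>y\<in>I. \<Sum>i<D. min (p x i) (p y i))"
    unfolding sum.swap[of _ I "{..<D}"] ..
  also have "\<dots> \<le> (\<Sum>x\<in>I. \<Sum>y\<in>I. \<delta> + (if x = y then 1 else 0))"
  proof (intro sum_mono)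
    fix x y assume "x \<in> I" "y \<in> I"
    then show "(\<Sum>i<D. min (p x i) (p y i)) \<le> \<delta> + (if x = y then 1 else 0)"
      using overlap[of x y] mass(2)[of x] \<delta> by auto
  qed
  also have "\<dots> = N * (N * \<delta> + 1)"
    using fin by (simp add: sum.distrib N_def)
  also have "\<dots> \<le> N * (2 * (\<delta> * N))" using N by (intro mult_left_mono) (auto simp: mult.commute)
  finally have "(4*\<delta>*N) * M \<le> (4*\<delta>*N) * (N / 2)" by (simp add: algebra_simps)
  moreover have "0 < 4*\<delta>*N" using \<delta> N by simp
  ultimately have M: "M \<le> N / 2" by (simp only: mult_le_cancel_left_pos)
  have "(\<Sum>x\<in>I. \<Sum>i<D. g x i) = (\<Sum>x\<in>I. \<Sum>i<D. p x i) - M"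
    by (simp add: g_def M_def sum_subtractf)
  moreover have "(\<Sum>x\<in>I. \<Sum>i<D. p x i) \<ge> (\<Sum>x\<in>I. 7/8)" using mass by (intro sum_mono) auto
  ultimately have gmass: "(\<Sum>x\<in>I. \<Sum>i<D. g x i) \<ge> 3/8 * N" using M by (simp add: N_def)
  have "(\<Sum>x\<in>I. real (card (A x))) = (\<Sum>x\<in>I. \<Sum>i<D. if p x i > \<theta> i then 1 else 0)"
    by (simp add: A_def sum.If_cases Int_def conj_commute)
  also have "\<dots> = (\<Sum>i<D. \<Sum>x\<in>I. if p x i > \<theta> i then 1 else 0)" by (rule sum.swap)
  also have "\<dots> = (\<Sum>i<D. real (card {x \<in> I. p x i > \<theta> i}))"
    using fin by (simp add: sum.If_cases Int_def)
  also have "\<dots> \<le> (\<Sum>i<D. 4*\<delta>*N)" using \<theta>(1) by (intro sum_mono)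
  finally have Acard: "(\<Sum>x\<in>I. real (card (A x))) \<le> 4*\<delta>*N * real D" by (simp add: mult.commute)
  \<comment> \<open>The rounding scale: \<open>Q * \<delta>\<close> bounds the overlap of any two rounded vectors, and \<open>Q\<close> is at
     least 4 times the average size of the support of \<open>g x\<close>, so that rounding loses little mass.\<close>
  define Q where "Q = 16 * R / \<delta>"
  have Q: "Q > 0" "Q * \<delta> = 16 * R" using \<delta> R by (auto simp: Q_def)
  \<comment> \<open>In \<open>G\<close> the rounded excess keeps at least \<open>Q / 16\<close> units, since rounding down costs at most
     one unit per coordinate of the support.\<close>
  define G where "G = {x \<in> I. (\<Sum>i<D. g x i) - real (card (A x)) / Q \<ge> 1/16}"
  have "4*\<delta>*N * real D \<le> N / 4 * Q"
  proof -
    have "4*\<delta>*N * real D * \<delta> = 4 * N * (\<delta>\<^sup>2 * real D)" by (simp add: power2_eq_square)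
    also have "\<dots> \<le> 4 * N * R" using R N by (intro mult_left_mono) auto
    also have "\<dots> = N / 4 * Q * \<delta>" using Q by (simp add: mult.assoc)
    finally show ?thesis using \<delta> by (simp only: mult_le_cancel_right_pos)
  qed
  then have "(\<Sum>x\<in>I. real (card (A x))) / Q \<le> N / 4" using Q Acard
    by (simp add: divide_le_eq)
  then have "N / 8 \<le> (\<Sum>x\<in>I. (\<Sum>i<D. g x i) - real (card (A x)) / Q)"
    using gmass by (simp add: sum_subtractf sum_divide_distrib)
  also have "\<dots> \<le> (\<Sum>x\<in>I. (if x \<in> G then 1 else 0) + 1/16)"
  proof (rule sum_mono)
    fix x assume x: "x \<in> I"
    have "(\<Sum>i<D. g x i) \<le> (\<Sum>i<D. p x i)" using gp[OF x] by (intro sum_mono) auto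
    moreover have "0 \<le> real (card (A x)) / Q" using Q by simp
    ultimately show "(\<Sum>i<D. g x i) - real (card (A x)) / Q \<le> (if x \<in> G then 1 else 0) + 1/16"
      using mass(2)[OF x] x by (auto simp: G_def)
  qed
  also have "\<dots> = real (card G) + N / 16"
  proof -
    have "I \<inter> G = G" by (auto simp: G_def)
    then show ?thesis using fin by (simp add: sum.distrib sum.If_cases N_def)
  qed
  finally have cardG: "N \<le> 16 * real (card G)" by simp
  define a where "a x i = nat \<lfloor>Q * g x i\<rfloor>" for x i
  have a_le: "real (a x i) \<le> Q * g x i" for x i using g0 Q by (simp add: a_def)
  have a_ge: "Q * g x i - 1 \<le> real (a x i)" for x i unfolding a_def by linarith
  \<comment> \<open>The least integer above \<open>16 * R\<close>, hence above every overlap.\<close>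
  define s where "s = nat \<lfloor>16 * R\<rfloor> + 1"
  have s: "16 * R < real s" "real s \<le> 17 * R" using R unfolding s_def by linarith+
  have s_Q: "17 * R \<le> Q / 16"
  proof -
    have "17 * R * \<delta> \<le> 17 * R * (1/32)" using \<delta> R by (intro mult_left_mono) auto
    also have "\<dots> \<le> R" using R by simp
    finally show ?thesis using \<delta> by (simp add: Q_def field_simps)
  qed
  have "card G \<le> (s + D - 1) choose s"
  proof (rule card_le_choose_of_small_overlap)
    fix x assume x: "x \<in> G"
    have "17 * R \<le> Q * (1/16)" using s_Q by simp
    also have "\<dots> \<le> Q * ((\<Sum>i<D. g x i) - real (card (A x)) / Q)"
      using x Q by (intro mult_left_mono) (auto simp: G_def)
    also have "\<dots> = Q * (\<Sum>i<D. g x i) - real (card (A x))"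
      using Q by (simp add: right_diff_distrib)
    also have "(\<Sum>i<D. g x i) = (\<Sum>i\<in>A x. g x i)"
      using gA finA by (intro sum.mono_neutral_right) auto
    also have "Q * \<dots> - real (card (A x)) = (\<Sum>i\<in>A x. Q * g x i - 1)"
      by (simp add: sum_subtractf sum_distrib_left)
    also have "\<dots> \<le> (\<Sum>i\<in>A x. real (a x i))" using a_ge by (intro sum_mono)
    also have "\<dots> \<le> (\<Sum>i<D. real (a x i))" using finA by (intro sum_mono2) auto
    finally have "real s \<le> real (\<Sum>i<D. a x i)" using s by simp
    then show "s \<le> (\<Sum>i<D. a x i)" by (simp only: of_nat_le_iff)
  next
    fix x y assume xy: "x \<in> G" "y \<in> G" "x \<noteq> y"
    then have I: "x \<in> I" "y \<in> I" by (auto simp: G_def)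
    have "real (\<Sum>i<D. min (a x i) (a y i)) \<le> (\<Sum>i<D. Q * min (p x i) (p y i))"
      unfolding of_nat_sum
    proof (rule sum_mono)
      fix i assume "i \<in> {..<D}"
      then have "Q * g x i \<le> Q * p x i" "Q * g y i \<le> Q * p y i"
        using gp I Q by auto
      then show "real (min (a x i) (a y i)) \<le> Q * min (p x i) (p y i)"
        using a_le[of x i] a_le[of y i] by (simp add: min_def)
    qed
    also have "\<dots> \<le> Q * \<delta>"
      unfolding sum_distrib_left [symmetric]
      using overlap[OF I xy(3)] Q(1) by (intro mult_left_mono) auto
    also have "\<dots> < real s" using Q s by simp
    finally show "(\<Sum>i<D. min (a x i) (a y i)) < s" by (simp only: of_nat_less_iff)
  qed
  then have "real (card G) \<le> real ((s + D - 1) choose s)" by simp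
  also have "\<dots> \<le> (exp 1 * real (s + D - 1) / real s) ^ s"
    by (rule choose_le_exp) (simp add: s_def)
  also have "\<dots> \<le> (exp 1 * (1 / \<delta>\<^sup>2)) ^ s"
  proof (rule power_mono)
    have \<delta>2: "0 < \<delta>\<^sup>2" "\<delta>\<^sup>2 \<le> 1/2"
      using \<delta> power_mono[of \<delta> "1/32" 2] by (auto simp: power2_eq_square)
    have "\<delta>\<^sup>2 * real (s + D - 1) \<le> \<delta>\<^sup>2 * real s + \<delta>\<^sup>2 * real D"
      using \<delta>2 by (simp flip: distrib_left)
    also have "\<dots> \<le> 1/2 * real s + R"
      using \<delta>2 R by (intro add_mono mult_right_mono) auto
    also have "\<dots> \<le> real s" using s R by simp
    finally have "real (s + D - 1) / real s \<le> 1 / \<delta>\<^sup>2"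
      using \<delta>2 s R by (simp add: field_simps)
    then show "exp 1 * real (s + D - 1) / real s \<le> exp 1 * (1 / \<delta>\<^sup>2)"
      using mult_left_mono[of "real (s + D - 1) / real s" "1 / \<delta>\<^sup>2" "exp 1"] by simp
  qed simp
  also have "exp 1 * (1 / \<delta>\<^sup>2) = exp (1 + 2 * ln (1 / \<delta>))"
  proof -
    have "exp (2 * ln (1 / \<delta>)) = exp (ln (1 / \<delta>)) ^ 2" by (rule exp_double)
    also have "exp (ln (1 / \<delta>)) = 1 / \<delta>" using \<delta> by (intro exp_ln) simp
    finally show ?thesis by (simp only: exp_add power_one_over)
  qed
  also have "\<dots> ^ s = exp (real s * (1 + 2 * ln (1 / \<delta>)))"
    by (simp only: exp_of_nat_mult)
  also have "\<dots> \<le> exp (51 * R * ln (1 / \<delta>))"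
  proof -
    have "exp 1 * \<delta> \<le> 3 * (1/32)" using exp_le \<delta> by (intro mult_mono) auto
    then have "exp 1 \<le> 1 / \<delta>" using \<delta> by (simp add: le_divide_eq)
    then have l: "1 \<le> ln (1 / \<delta>)" using \<delta> by (simp add: ln_ge_iff)
    have "real s * (1 + 2 * ln (1 / \<delta>)) \<le> (17 * R) * (3 * ln (1 / \<delta>))"
      using s l R by (intro mult_mono) auto
    then show ?thesis by simp
  qed
  finally show ?thesis using cardG by (simp add: N_def)
qed

section \<open>Distortion and scaling\<close>

lemma le_lip_norm:
  assumes "x \<in> X" "y \<in> X" "x \<noteq> y"
  shows "ennreal (dY (f x) (f y) / dX x y) \<le> lip_norm X dX dY f"
  unfolding lip_norm_def using assms by (intro SUP_upper2[of "(x, y)"]) auto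

text \<open>
  A second point is needed: on a single point both Lipschitz constants vanish. Otherwise
  they are positive, and as their product is finite, so are they; the scale \<open>r\<close> is the
  Lipschitz constant of the inverse.
\<close>

lemma is_embedding_scaled:
  assumes X: "Metric_space X dX" and Y: "Metric_space Y dY"
    and emb: "is_embedding D X dX Y dY f"
    and two: "x0 \<in> X" "y0 \<in> X" "x0 \<noteq> y0"
  obtains r where "r > 0"
    "\<And>x y. x \<in> X \<Longrightarrow> y \<in> X \<Longrightarrow> dX x y \<le> r * dY (f x) (f y)"
    "\<And>x y. x \<in> X \<Longrightarrow> y \<in> X \<Longrightarrow> r * dY (f x) (f y) \<le> D * dX x y"
proof -
  interpret X: Metric_space X dX by (rule X)
  interpret Y: Metric_space Y dY by (rule Y)
  define L where "L = lip_norm X dX dY f"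
  define K where "K = lip_norm (f ` X) dY dX (inv_into X f)"
  have fY: "f x \<in> Y" if "x \<in> X" for x using emb that by (auto simp: is_embedding_def)
  have inj: "inj_on f X" and LK: "L * K \<le> ennreal D"
    using emb by (auto simp: is_embedding_def distortion_def L_def K_def top_unique split: if_splits)
  have posX: "0 < dX x y" if "x \<in> X" "y \<in> X" "x \<noteq> y" for x y
    using X.mdist_pos_less that by blast
  have posY: "0 < dY (f x) (f y)" if "x \<in> X" "y \<in> X" "x \<noteq> y" for x y
    using Y.mdist_pos_less fY inj that by (metis inj_onD)
  have L: "ennreal (dY (f x) (f y) / dX x y) \<le> L" if "x \<in> X" "y \<in> X" "x \<noteq> y" for x y
    unfolding L_def using that by (rule le_lip_norm)
  have K: "ennreal (dX x y / dY (f x) (f y)) \<le> K" if "x \<in> X" "y \<in> X" "x \<noteq> y" for x y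
    using le_lip_norm[of "f x" "f ` X" "f y" dX "inv_into X f" dY] that inj
    by (auto simp: K_def inv_into_f_f inj_on_eq_iff)
  have "0 < ennreal (dY (f x0) (f y0) / dX x0 y0)" "0 < ennreal (dX x0 y0 / dY (f x0) (f y0))"
    using posX[OF two] posY[OF two] by simp_all
  then have "0 < L" "0 < K"
    using L[OF two] K[OF two] by (blast intro: less_le_trans)+
  moreover have "L * K < top" using LK ennreal_less_top le_less_trans by blast
  ultimately have fin: "L < top" "K < top" by (auto simp: ennreal_mult_less_top)
  define l r where "l = enn2real L" and "r = enn2real K"
  have lr: "L = ennreal l" "K = ennreal r" "0 < l" "0 < r"
    using fin \<open>0 < L\<close> \<open>0 < K\<close> by (auto simp: l_def r_def enn2real_positive_iff)
  have "ennreal (l * r) \<le> ennreal D" using LK lr by (simp add: ennreal_mult)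
  moreover have "0 < l * r" using lr by simp
  ultimately have prod: "l * r \<le> D" by (auto simp: ennreal_le_iff2)
  show ?thesis
  proof
    show "r > 0" by (rule lr)
    fix x y assume xy: "x \<in> X" "y \<in> X"
    show "dX x y \<le> r * dY (f x) (f y)"
    proof (cases "x = y")
      case False
      then show ?thesis using K[OF xy] posY[OF xy] lr by (simp add: field_simps)
    qed (use xy fY in simp)
    show "r * dY (f x) (f y) \<le> D * dX x y"
    proof (cases "x = y")
      case False
      then have "dY (f x) (f y) \<le> l * dX x y" using L[OF xy] posX[OF xy] lr by (simp add: field_simps)
      then have "r * dY (f x) (f y) \<le> r * (l * dX x y)" using lr by simp
      also have "\<dots> = (l * r) * dX x y" by simp
      also have "\<dots> \<le> D * dX x y" using prod by (intro mult_right_mono) auto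
      finally show ?thesis .
    qed (use xy fY in simp)
  qed
qed

section \<open>Distances in the complete tree\<close>

text \<open>
  The length of the path between two vertices through their last common ancestor, which is
  where their paths from the root fork.
\<close>

fun fork_dist :: "'a list \<Rightarrow> 'a list \<Rightarrow> nat" where
  "fork_dist [] v = length v"
| "fork_dist (a # u) [] = length (a # u)"
| "fork_dist (a # u) (b # v) =
     (if a = b then fork_dist u v else length (a # u) + length (b # v))"

lemma fork_dist_self [simp]: "fork_dist u u = 0"
  by (induction u) auto

lemma fork_dist_Nil [simp]: "fork_dist u [] = length u"
  by (cases u) auto

text \<open>
  An edge of the tree appends or removes one letter, so this says that the length of the path
  to \<open>u\<close> changes by at most 1 along an edge.
\<close>

lemma fork_dist_snoc:
  "fork_dist u (v @ [a]) \<le> Suc (fork_dist u v)" "fork_dist u v \<le> Suc (fork_dist u (v @ [a]))"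
  by (induction u v rule: fork_dist.induct) (auto simp: neq_Nil_conv)

text \<open>
  Different words of the same length fork before their ends, so whatever is appended to them
  lengthens the path by its own length.
\<close>

lemma fork_dist_append:
  assumes "length u = length v" "u \<noteq> v"
  shows "\<exists>w u' v'. u = w @ u' \<and> v = w @ v' \<and> u' \<noteq> [] \<and> length u' = length v' \<and>
    (\<forall>p q. fork_dist (u @ p) (v @ q) = length (u' @ p) + length (v' @ q))"
  using assms
proof (induction u v rule: list_induct2)
  case (Cons a u b v)
  show ?case
  proof (cases "a = b")
    case True
    with Cons obtain w u' v' where "u = w @ u'" "v = w @ v'" "u' \<noteq> []" "length u' = length v'"
      "\<forall>p q. fork_dist (u @ p) (v @ q) = length (u' @ p) + length (v' @ q)" by blast
    with True show ?thesis by (intro exI[of _ "a # w"] exI[of _ u'] exI[of _ v']) auto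
  next
    case False
    with Cons.hyps show ?thesis
      by (intro exI[of _ "[]"] exI[of _ "a # u"] exI[of _ "b # v"]) auto
  qed
qed simp

lemma fork_dist_le_tree_walk:
  "(u, v) \<in> tree_edges k h ^^ n \<Longrightarrow> fork_dist u v \<le> n"
proof (induction n arbitrary: v)
  case (Suc n)
  then obtain z where z: "(u, z) \<in> tree_edges k h ^^ n" "(z, v) \<in> tree_edges k h" by auto
  have "fork_dist u v \<le> Suc (fork_dist u z)"
    using z(2) fork_dist_snoc by (auto simp: tree_edges_def)
  then show ?case using Suc.IH[OF z(1)] by simp
qed auto

lemma tree_verts_appendD: "u @ p \<in> tree_verts k h \<Longrightarrow> u \<in> tree_verts k h"
  by (auto simp: tree_verts_def)

lemma tree_walk_append:
  "u @ p \<in> tree_verts k h \<Longrightarrow> (u, u @ p) \<in> tree_edges k h ^^ length p"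
proof (induction p rule: rev_induct)
  case (snoc a p)
  then have "u @ p \<in> tree_verts k h" using tree_verts_appendD[of "u @ p" "[a]"] by simp
  moreover have "(u @ p, u @ p @ [a]) \<in> tree_edges k h"
    using snoc.prems calculation by (auto simp: tree_edges_def)
  ultimately show ?case using snoc.IH by auto
qed simp

lemma tree_dist_append_le:
  "u @ p \<in> tree_verts k h \<Longrightarrow> tree_dist k h u (u @ p) \<le> real (length p)"
  unfolding graph_dist_def of_nat_le_iff by (rule Least_le) (rule tree_walk_append)

lemma fork_dist_le_tree_dist:
  assumes "u \<in> tree_verts k h" "v \<in> tree_verts k h"
  shows "real (fork_dist u v) \<le> tree_dist k h u v"
proof -
  have "(u, []) \<in> tree_edges k h ^^ length u"
    by (rule iffD1[OF relpow_sym_swap[OF tree_edges_sym] tree_root_path[OF assms(1)]])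
  from relpow_trans[OF this tree_root_path[OF assms(2)]]
  have "\<exists>n. (u, v) \<in> tree_edges k h ^^ n" ..
  then show ?thesis
    unfolding graph_dist_def of_nat_le_iff by (rule fork_dist_le_tree_walk[OF LeastI_ex])
qed

section \<open>Splitting vectors into positive and negative parts\<close>

text \<open>
  The positive parts of the \<open>d\<close> coordinates followed by the negative parts. This maps
  \<open>\<real>\<^sup>d\<close> isometrically, in the \<open>l\<^sub>1\<close> distance, to vectors with \<open>2 * d\<close> nonnegative entries, whose sum
  is then the norm.
\<close>

definition sign_split :: "nat \<Rightarrow> (nat \<Rightarrow> real) \<Rightarrow> nat \<Rightarrow> real" where
  "sign_split d x i = (if i < d then max 0 (x i) else max 0 (- x (i - d)))"

lemma sum_lessThan_add: "(\<Sum>i<m + n. f i) = (\<Sum>i<m. f i) + (\<Sum>i<n. f (m + i))"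
  for f :: "nat \<Rightarrow> real"
  by (induction n) (simp_all add: add.assoc)

lemma sign_split_nonneg: "0 \<le> sign_split d x i"
  by (simp add: sign_split_def)

lemma sum_sign_split: "(\<Sum>i<d + d. sign_split d x i) = (\<Sum>i<d. \<bar>x i\<bar>)"
  unfolding sum_lessThan_add sum.distrib [symmetric]
  by (intro sum.cong) (auto simp: sign_split_def)

lemma sum_abs_sign_split_diff:
  "(\<Sum>i<d + d. \<bar>sign_split d x i - sign_split d y i\<bar>) = (\<Sum>i<d. \<bar>x i - y i\<bar>)"
  unfolding sum_lessThan_add sum.distrib [symmetric]
  by (intro sum.cong) (auto simp: sign_split_def max_def)

lemma sum_min_sign_split:
  "(\<Sum>i<d + d. min (sign_split d x i) (sign_split d y i)) =
     ((\<Sum>i<d. \<bar>x i\<bar>) + (\<Sum>i<d. \<bar>y i\<bar>) - (\<Sum>i<d. \<bar>x i - y i\<bar>)) / 2"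
proof -
  have "min a b = (a + b - \<bar>a - b\<bar>) / 2" for a b :: real by (simp add: min_def)
  then show ?thesis
    by (simp only: sum_divide_distrib [symmetric] sum_subtractf sum.distrib
        sum_sign_split sum_abs_sign_split_diff)
qed

section \<open>Displacement vectors of a tree embedding\<close>

definition level :: "nat \<Rightarrow> nat \<Rightarrow> nat list set" where
  "level k n = {u. set u \<subseteq> {..<k} \<and> length u = n}"

lemma finite_level: "finite (level k n)" and card_level: "card (level k n) = k ^ n"
  by (simp_all add: level_def finite_lists_length_eq card_lists_length_eq)

text \<open>
  The vertices considered are the \<open>k ^ n\<close> vertices of depth \<open>n\<close> and one descendant of each at depth
  \<open>2 * n\<close>.
\<close>

locale scaled_tree_embedding =
  fixes \<epsilon> r :: real and k h d n :: nat and f :: "nat list \<Rightarrow> nat \<Rightarrow> real"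
  assumes r: "0 < r" and \<epsilon>: "0 < \<epsilon>" and k: "2 \<le> k" and n: "0 < n" "2 * n \<le> h"
    and lower: "\<And>x y. x \<in> tree_verts k h \<Longrightarrow> y \<in> tree_verts k h \<Longrightarrow>
      tree_dist k h x y \<le> r * l1_dist d (f x) (f y)"
    and upper: "\<And>x y. x \<in> tree_verts k h \<Longrightarrow> y \<in> tree_verts k h \<Longrightarrow>
      r * l1_dist d (f x) (f y) \<le> (1 + \<epsilon>) * tree_dist k h x y"
begin

abbreviation ext :: "nat list \<Rightarrow> nat list" where
  "ext u \<equiv> u @ replicate n 0"

definition displ :: "nat list \<Rightarrow> nat list \<Rightarrow> nat \<Rightarrow> real" where
  "displ u v i = r * (f v i - f u i)"

lemma level_verts: "u \<in> level k n \<Longrightarrow> ext u \<in> tree_verts k h"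
  "u \<in> level k n \<Longrightarrow> u \<in> tree_verts k h"
  "[] \<in> tree_verts k h"
  using k n by (auto simp: level_def tree_verts_def set_replicate_conv_if)

lemma norm_displ: "(\<Sum>i<d. \<bar>displ u v i\<bar>) = r * l1_dist d (f u) (f v)"
  using r by (simp add: displ_def l1_dist_def abs_mult sum_distrib_left abs_minus_commute)

lemma norm_displ_append_le:
  assumes "u @ p \<in> tree_verts k h"
  shows "(\<Sum>i<d. \<bar>displ u (u @ p) i\<bar>) \<le> (1 + \<epsilon>) * real (length p)"
proof -
  have "(\<Sum>i<d. \<bar>displ u (u @ p) i\<bar>) \<le> (1 + \<epsilon>) * tree_dist k h u (u @ p)"
    unfolding norm_displ using upper assms tree_verts_appendD by blast
  also have "\<dots> \<le> (1 + \<epsilon>) * real (length p)"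
    using \<epsilon> tree_dist_append_le[OF assms] by (intro mult_left_mono) auto
  finally show ?thesis .
qed

lemma norm_displ_ge:
  assumes "u \<in> tree_verts k h" "v \<in> tree_verts k h"
  shows "real (fork_dist u v) \<le> (\<Sum>i<d. \<bar>displ u v i\<bar>)"
  unfolding norm_displ using fork_dist_le_tree_dist lower assms by (meson order_trans)

lemma norm_displ_ext:
  assumes "u \<in> level k n"
  shows "real n \<le> (\<Sum>i<d. \<bar>displ u (ext u) i\<bar>)"
    and "(\<Sum>i<d. \<bar>displ u (ext u) i\<bar>) \<le> (1 + \<epsilon>) * real n"
proof -
  have "fork_dist u (u @ p) = length p" for p :: "nat list"
    by (induction u) auto
  then show "real n \<le> (\<Sum>i<d. \<bar>displ u (ext u) i\<bar>)"
    using norm_displ_ge[OF level_verts(2)[OF assms] level_verts(1)[OF assms]] by simp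
  show "(\<Sum>i<d. \<bar>displ u (ext u) i\<bar>) \<le> (1 + \<epsilon>) * real n"
    using norm_displ_append_le[OF level_verts(1)[OF assms]] by simp
qed

lemma level_fork:
  assumes "u \<in> level k n" "v \<in> level k n" "u \<noteq> v"
  obtains w u' v' where "u = w @ u'" "v = w @ v'" "0 < length u'" "length u' \<le> n"
    "length v' = length u'" "fork_dist (ext u) (ext v) = 2 * (length u' + n)"
proof -
  have "length u = length v" "length u = n" using assms by (auto simp: level_def)
  then obtain w u' v' where w: "u = w @ u'" "v = w @ v'" "u' \<noteq> []" "length u' = length v'"
    "\<forall>p q. fork_dist (u @ p) (v @ q) = length (u' @ p) + length (v' @ q)"
    using fork_dist_append[of u v] assms(3) by blast
  with \<open>length u = n\<close> show ?thesis
    by (intro that[of w u' v']) auto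
qed

text \<open>
  The key to a bound that is linear in \<open>h\<close>. Vertices \<open>u\<close> and \<open>v\<close> that fork \<open>l\<close> levels
  above them are at distance only \<open>2 * l\<close>, but their extensions are at distance \<open>2 * (l + n)\<close>.
  Subtracting the images of \<open>u\<close> and \<open>v\<close> costs at most \<open>2 * (1 + \<epsilon>) * l\<close>, so the two displacements
  differ by almost \<open>2 * n\<close> whatever \<open>l\<close> is: all \<open>k ^ n\<close> displacements are almost
  equidistant, although the vertices themselves are far from it.
\<close>

lemma displ_ext_separated:
  assumes "u \<in> level k n" "v \<in> level k n" "u \<noteq> v"
  shows "2 * (1 - \<epsilon>) * real n \<le> (\<Sum>i<d. \<bar>displ u (ext u) i - displ v (ext v) i\<bar>)"
proof -
  obtain w u' v' where w: "u = w @ u'" "v = w @ v'" "length u' \<le> n" "length v' = length u'"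
      "fork_dist (ext u) (ext v) = 2 * (length u' + n)"
    by (rule level_fork[OF assms])
  define l where "l = real (length u')"
  have "\<epsilon> * l \<le> \<epsilon> * real n" using w \<epsilon> by (simp add: l_def)
  moreover have "2 * (l + real n) \<le> (\<Sum>i<d. \<bar>displ (ext u) (ext v) i\<bar>)"
    using norm_displ_ge[OF level_verts(1)[OF assms(1)] level_verts(1)[OF assms(2)]] w(5) by (simp add: l_def)
  moreover have "(\<Sum>i<d. \<bar>displ w u i\<bar>) \<le> (1 + \<epsilon>) * l"
    using norm_displ_append_le[of w u'] level_verts(2)[OF assms(1)] w by (simp add: l_def)
  moreover have "(\<Sum>i<d. \<bar>displ w v i\<bar>) \<le> (1 + \<epsilon>) * l"
    using norm_displ_append_le[of w v'] level_verts(2)[OF assms(2)] w by (simp add: l_def)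
  moreover have "(\<Sum>i<d. \<bar>displ (ext u) (ext v) i\<bar>) \<le>
      (\<Sum>i<d. \<bar>displ u (ext u) i - displ v (ext v) i\<bar> + \<bar>displ w u i\<bar> + \<bar>displ w v i\<bar>)"
  proof (rule sum_mono)
    fix i
    have "displ (ext u) (ext v) i =
        displ v (ext v) i - displ u (ext u) i + displ w v i - displ w u i"
      by (simp add: displ_def algebra_simps)
    then show "\<bar>displ (ext u) (ext v) i\<bar> \<le>
        \<bar>displ u (ext u) i - displ v (ext v) i\<bar> + \<bar>displ w u i\<bar> + \<bar>displ w v i\<bar>"
      by linarith
  qed
  ultimately show ?thesis by (simp add: sum.distrib algebra_simps)
qed

text \<open>
  Two vectors of norm about \<open>n\<close> at distance almost \<open>2 * n\<close> have almost disjoint sign splits, which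
  makes the packing bound applicable to the displacements. Here \<open>8 * \<epsilon>\<^sup>2 * d\<close> is \<open>\<delta>\<^sup>2 * D\<close> for
  \<open>\<delta> = 2 * \<epsilon>\<close> and \<open>D = 2 * d\<close>.
\<close>

lemma card_level_le_of_small_eps:
  assumes "\<epsilon> \<le> 1/64" and R: "1 \<le> R" "8 * \<epsilon>\<^sup>2 * real d \<le> R" and many: "1 \<le> 2 * \<epsilon> * real k ^ n"
  shows "real k ^ n \<le> 16 * exp (51 * R * ln (1 / (2 * \<epsilon>)))"
proof -
  define c where "c = (1 + \<epsilon>) * real n"
  define p where "p u i = sign_split d (displ u (ext u)) i / c" for u i
  have c: "0 < c" using \<epsilon> n by (simp add: c_def)
  have sum_p: "(\<Sum>i<d + d. p u i) = (\<Sum>i<d. \<bar>displ u (ext u) i\<bar>) / c" for u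
    by (simp add: p_def sum_sign_split flip: sum_divide_distrib)
  have "real (card (level k n)) \<le> 16 * exp (51 * R * ln (1 / (2 * \<epsilon>)))"
  proof (rule card_le_of_small_overlap[where D = "d + d" and p = p])
    fix u assume u: "u \<in> level k n"
    have "7/8 * c \<le> real n" using \<epsilon> assms(1) n by (simp add: c_def)
    then have "7/8 * c \<le> (\<Sum>i<d. \<bar>displ u (ext u) i\<bar>)"
      using norm_displ_ext(1)[OF u] by linarith
    then show "7/8 \<le> (\<Sum>i<d + d. p u i)"
      unfolding sum_p using c by (simp add: le_divide_eq)
    show "(\<Sum>i<d + d. p u i) \<le> 1"
      unfolding sum_p using c norm_displ_ext(2)[OF u] by (simp add: c_def)
  next
    fix u v assume uv: "u \<in> level k n" "v \<in> level k n" "u \<noteq> v"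
    have "(\<Sum>i<d + d. min (p u i) (p v i)) =
        (\<Sum>i<d + d. min (sign_split d (displ u (ext u)) i) (sign_split d (displ v (ext v)) i)) / c"
      using c by (simp add: p_def min_divide_distrib_right sum_divide_distrib)
    also have "\<dots> \<le> (2 * \<epsilon> * real n) / c"
      using norm_displ_ext(2)[OF uv(1)] norm_displ_ext(2)[OF uv(2)] displ_ext_separated[OF uv] c
      unfolding sum_min_sign_split by (intro divide_right_mono) (simp_all add: algebra_simps)
    also have "\<dots> \<le> 2 * \<epsilon>"
      using \<epsilon> n c by (simp add: c_def field_simps)
    finally show "(\<Sum>i<d + d. min (p u i) (p v i)) \<le> 2 * \<epsilon>" .
  qed (use assms \<epsilon> c in \<open>auto simp: p_def sign_split_nonneg finite_level card_level
        power2_eq_square\<close>)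
  then show ?thesis by (simp add: card_level)
qed

text \<open>
  A volume bound, for distortion far from 1: the images of the chosen descendants are at
  distance more than \<open>2 * n\<close> from each other and lie in a ball of radius \<open>2 * (1 + \<epsilon>) * n\<close> around
  the image of the root. Their sign splits remain distinct when rounded down to multiples of
  \<open>2 * n / D\<close>, so they are at most as many as the nonnegative lattice points in a ball of radius
  \<open>(1 + \<epsilon>) * D\<close>, where \<open>D = 2 * d\<close>.
\<close>

lemma log_card_level_le_dim:
  "real n * ln (real k) \<le> 2 * (2 + \<epsilon>) * real d"
proof -
  define D where "D = d + d"
  define p where "p u i = sign_split d (displ [] (ext u)) i" for u i
  define t where "t = real D / (2 * real n)"
  define a where "a u i = nat \<lfloor>t * p u i\<rfloor>" for u i
  define S where "S = nat \<lfloor>(1 + \<epsilon>) * real D\<rfloor>"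
  have t: "0 \<le> t" "t * (2 * real n) = real D" using n by (simp_all add: t_def)
  have p0: "0 \<le> p u i" for u i by (simp add: p_def sign_split_nonneg)
  have a: "real (a u i) \<le> t * p u i" "t * p u i < real (a u i) + 1" for u i
  proof -
    have "0 \<le> t * p u i" using p0 t by simp
    then show "real (a u i) \<le> t * p u i" "t * p u i < real (a u i) + 1"
      unfolding a_def by linarith+
  qed
  have "card (level k n) \<le> 2 ^ (D + S)"
  proof (rule card_le_pow2_of_distinct)
    fix u assume u: "u \<in> level k n"
    have "real (\<Sum>i<D. a u i) \<le> (\<Sum>i<D. t * p u i)"
      unfolding of_nat_sum using a by (intro sum_mono)
    also have "\<dots> = t * (\<Sum>i<d. \<bar>displ [] (ext u) i\<bar>)"
      unfolding p_def D_def sum_distrib_left [symmetric] sum_sign_split ..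
    also have "\<dots> \<le> t * ((1 + \<epsilon>) * (2 * real n))"
    proof (rule mult_left_mono)
      have "length (ext u) = 2 * n" using u by (simp add: level_def)
      then show "(\<Sum>i<d. \<bar>displ [] (ext u) i\<bar>) \<le> (1 + \<epsilon>) * (2 * real n)"
        using norm_displ_append_le[of "[]" "ext u"] level_verts(1)[OF u] by simp
    qed (rule t)
    also have "\<dots> = (1 + \<epsilon>) * real D" using t by (simp add: algebra_simps)
    finally show "(\<Sum>i<D. a u i) \<le> S" unfolding S_def by linarith
  next
    fix u v assume uv: "u \<in> level k n" "v \<in> level k n" "u \<noteq> v"
    show "\<exists>i<D. a u i \<noteq> a v i"
    proof (rule ccontr)
      assume "\<not> (\<exists>i<D. a u i \<noteq> a v i)"
      then have eq: "a u i = a v i" if "i < D" for i using that by blast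
      obtain l where l: "0 < l" "fork_dist (ext u) (ext v) = 2 * (l + n)"
        by (rule level_fork[OF uv]) blast
      have "2 * real n < real (fork_dist (ext u) (ext v))" using l by simp
      also have "\<dots> \<le> (\<Sum>i<d. \<bar>displ (ext u) (ext v) i\<bar>)"
        using norm_displ_ge level_verts(1) uv by blast
      also have "\<dots> = (\<Sum>i<d. \<bar>displ [] (ext u) i - displ [] (ext v) i\<bar>)"
        by (intro sum.cong refl) (simp add: displ_def right_diff_distrib abs_minus_commute)
      also have "\<dots> = (\<Sum>i<D. \<bar>p u i - p v i\<bar>)"
        by (simp add: p_def D_def sum_abs_sign_split_diff)
      also have "\<dots> \<le> (\<Sum>i<D. 2 * real n / real D)"
      proof (rule sum_mono)
        fix i assume i: "i \<in> {..<D}"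
        then have D: "0 < real D" by auto
        then have "0 < t" using n by (simp add: t_def)
        have "t * p u i - t * p v i \<le> 1" "t * p v i - t * p u i \<le> 1"
          using a[of u i] a[of v i] eq[of i] i by simp_all
        then have "t * \<bar>p u i - p v i\<bar> \<le> 1" by (cases "p u i \<ge> p v i") (simp_all add: right_diff_distrib)
        then have "\<bar>p u i - p v i\<bar> \<le> 1 / t" using \<open>0 < t\<close> by (simp add: field_simps)
        then show "\<bar>p u i - p v i\<bar> \<le> 2 * real n / real D" by (simp add: t_def)
      qed
      also have "\<dots> \<le> 2 * real n" by simp
      finally show False by simp
    qed
  qed
  then have "real (k ^ n) \<le> real (2 ^ (D + S))" unfolding card_level of_nat_le_iff .
  then have "ln (real k ^ n) \<le> ln (2 ^ (D + S))" using k by simp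
  then have "real n * ln (real k) \<le> real (D + S) * ln 2"
    using k by (simp only: ln_realpow)
  also have "\<dots> \<le> real (D + S) * 1"
    using ln_le_minus_one[of "2::real"] by (intro mult_left_mono) auto
  also have "\<dots> \<le> 2 * (2 + \<epsilon>) * real d"
  proof -
    have "0 \<le> (1 + \<epsilon>) * real D" using \<epsilon> by simp
    then have "real S \<le> (1 + \<epsilon>) * real D" unfolding S_def by linarith
    then show ?thesis by (simp add: D_def algebra_simps)
  qed
  finally show ?thesis .
qed

lemma dim_lower_bound:
  assumes h: "real h \<le> 3 * real n"
    and many: "2 * ln 16 + 51 * ln (1 / (2 * \<epsilon>)) + 1 \<le> real n * ln (real k)"
  shows "1/50000 * (real h * ln (real k)) / (\<epsilon>\<^sup>2 * max 1 (ln (1 / \<epsilon>))) \<le> real d"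
proof -
  define m where "m = max 1 (ln (1 / \<epsilon>))"
  define E where "E = real n * ln (real k)"
  have m: "1 \<le> m" "ln (1 / \<epsilon>) \<le> m" by (auto simp: m_def)
  have "E \<le> 16512 * (real d * (\<epsilon>\<^sup>2 * m))"
  proof (cases "\<epsilon> \<le> 1/64")
    case True
    have E: "real k ^ n = exp E" using k by (simp add: E_def exp_of_nat_mult)
    have l: "ln (1 / (2 * \<epsilon>)) \<le> m"
      using m \<epsilon> by (intro order_trans[OF _ m(2)]) (simp add: field_simps)
    have l0: "0 \<le> ln (1 / (2 * \<epsilon>))" using True \<epsilon> by simp
    have l16: "0 \<le> ln (16 :: real)" by simp
    have "ln (1 / (2 * \<epsilon>)) \<le> E" using many l0 l16 unfolding E_def by linarith
    then have "exp (ln (1 / (2 * \<epsilon>))) \<le> exp E" by (simp only: exp_le_cancel_iff)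
    moreover have "exp (ln (1 / (2 * \<epsilon>))) = 1 / (2 * \<epsilon>)" using \<epsilon> by (intro exp_ln) simp
    ultimately have "1 / (2 * \<epsilon>) \<le> exp E" by (simp only:)
    then have large: "1 \<le> 2 * \<epsilon> * real k ^ n" unfolding E using \<epsilon> by (simp add: field_simps)
    have key: "E \<le> ln 16 + 51 * R * ln (1 / (2 * \<epsilon>))"
      if "1 \<le> R" "8 * \<epsilon>\<^sup>2 * real d \<le> R" for R
    proof -
      have "exp E \<le> exp (ln 16 + 51 * R * ln (1 / (2 * \<epsilon>)))"
        using card_level_le_of_small_eps[OF True that large] by (simp add: E exp_add)
      then show ?thesis by (simp only: exp_le_cancel_iff)
    qed
    \<comment> \<open>The tree is so high that \<open>R = 1\<close> violates the packing bound, so \<open>R = 8 * \<epsilon>\<^sup>2 * d\<close> is at least 1.\<close>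
    have "1 < 8 * \<epsilon>\<^sup>2 * real d"
    proof (rule ccontr)
      assume "\<not> 1 < 8 * \<epsilon>\<^sup>2 * real d"
      then have "E \<le> ln 16 + 51 * 1 * ln (1 / (2 * \<epsilon>))" by (intro key) auto
      then show False using many l0 l16 unfolding E_def by linarith
    qed
    then have "E \<le> ln 16 + 51 * (8 * \<epsilon>\<^sup>2 * real d) * ln (1 / (2 * \<epsilon>))" by (intro key) auto
    moreover have "2 * ln 16 \<le> E" using many l0 unfolding E_def by linarith
    moreover have "51 * (8 * \<epsilon>\<^sup>2 * real d) * ln (1 / (2 * \<epsilon>)) \<le> 51 * (8 * \<epsilon>\<^sup>2 * real d) * m"
      using l by (intro mult_left_mono) auto
    ultimately have "E \<le> 816 * (real d * (\<epsilon>\<^sup>2 * m))" by (simp add: algebra_simps)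
    also have "\<dots> \<le> 16512 * (real d * (\<epsilon>\<^sup>2 * m))"
      using m by (intro mult_right_mono) auto
    finally show ?thesis .
  next
    case False
    have "E \<le> 2 * (2 + \<epsilon>) * real d" unfolding E_def by (rule log_card_level_le_dim)
    also have "\<dots> \<le> 2 * (8256 * \<epsilon>\<^sup>2) * real d"
    proof -
      \<comment> \<open>Away from 0 the factor \<open>2 + \<epsilon>\<close> is at most a multiple of \<open>\<epsilon>\<^sup>2\<close>.\<close>
      have "2 + \<epsilon> \<le> 129 * \<epsilon> * 1" using False by simp
      also have "\<dots> \<le> 129 * \<epsilon> * (64 * \<epsilon>)" using False \<epsilon> by (intro mult_left_mono) auto
      finally show ?thesis by (intro mult_right_mono mult_left_mono) (auto simp: power2_eq_square)
    qed
    also have "\<dots> = 16512 * (real d * \<epsilon>\<^sup>2) * 1" by simp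
    also have "\<dots> \<le> 16512 * (real d * \<epsilon>\<^sup>2) * m" using m by (intro mult_left_mono) auto
    finally show ?thesis by (simp add: mult.assoc)
  qed
  moreover have "real h * ln (real k) \<le> 3 * E"
    using mult_right_mono[OF h, of "ln (real k)"] k by (simp add: E_def)
  moreover have "0 \<le> real d * (\<epsilon>\<^sup>2 * m)" using m by simp
  ultimately have "1/50000 * (real h * ln (real k)) \<le> real d * (\<epsilon>\<^sup>2 * m)" by linarith
  then show ?thesis using \<epsilon> m by (simp add: divide_le_eq flip: m_def)
qed

end

section \<open>The dimension bound\<close>

theorem corollary3:
  shows "\<exists>c::real. c > 0 \<and>
    (\<forall>\<epsilon>::real. \<forall>k::nat. \<epsilon> > 0 \<longrightarrow> k \<ge> 2 \<longrightarrow>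
      (\<forall>\<^sub>F h in sequentially. \<forall>(d::nat) (f :: nat list \<Rightarrow> nat \<Rightarrow> real).
        is_embedding (1 + \<epsilon>) (tree_verts k h) (tree_dist k h) (l1_space d) (l1_dist d) f \<longrightarrow>
        real d \<ge> c * (real h * ln (real k)) / (\<epsilon>\<^sup>2 * max 1 (ln (1 / \<epsilon>)))))"
proof (intro exI[of _ "1/50000"] conjI allI impI)
  fix \<epsilon> :: real and k :: nat
  assume \<epsilon>: "0 < \<epsilon>" and k: "2 \<le> k"
  define C where "C = 2 * ln 16 + 51 * ln (1 / (2 * \<epsilon>)) + 1"
  have lnk: "0 < ln (real k)" using k by simp
  have "\<forall>\<^sub>F h in sequentially. 2 \<le> h \<and> nat \<lceil>3 * C / ln (real k)\<rceil> \<le> h"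
    by (intro eventually_conj eventually_ge_at_top)
  then show "\<forall>\<^sub>F h in sequentially. \<forall>(d::nat) (f :: nat list \<Rightarrow> nat \<Rightarrow> real).
      is_embedding (1 + \<epsilon>) (tree_verts k h) (tree_dist k h) (l1_space d) (l1_dist d) f \<longrightarrow>
      real d \<ge> 1/50000 * (real h * ln (real k)) / (\<epsilon>\<^sup>2 * max 1 (ln (1 / \<epsilon>)))"
  proof (rule eventually_mono, intro allI impI)
    fix h d :: nat and f :: "nat list \<Rightarrow> nat \<Rightarrow> real"
    assume h: "2 \<le> h \<and> nat \<lceil>3 * C / ln (real k)\<rceil> \<le> h"
      and emb: "is_embedding (1 + \<epsilon>) (tree_verts k h) (tree_dist k h) (l1_space d) (l1_dist d) f"
    define n where "n = h div 2"
    have "0 < n" "2 * n \<le> h" "h \<le> 3 * n" using h unfolding n_def by linarith+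
    then have nh: "0 < n" "2 * n \<le> h" "real h \<le> 3 * real n" by linarith+
    have two: "[] \<in> tree_verts k h" "[0] \<in> tree_verts k h" "[] \<noteq> [0 :: nat]"
      using h k by (auto simp: tree_verts_def)
    from is_embedding_scaled[OF Metric_space_tree Metric_space_l1 emb two]
    obtain r where r: "r > 0"
      "\<And>x y. x \<in> tree_verts k h \<Longrightarrow> y \<in> tree_verts k h \<Longrightarrow>
        tree_dist k h x y \<le> r * l1_dist d (f x) (f y)"
      "\<And>x y. x \<in> tree_verts k h \<Longrightarrow> y \<in> tree_verts k h \<Longrightarrow>
        r * l1_dist d (f x) (f y) \<le> (1 + \<epsilon>) * tree_dist k h x y"
      by blast
    interpret scaled_tree_embedding \<epsilon> r k h d n f
      by unfold_locales (use r \<epsilon> k nh in auto)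
    have "3 * C / ln (real k) \<le> real h" using h by linarith
    then have "3 * C \<le> real h * ln (real k)" using lnk by (simp add: divide_le_eq)
    also have "\<dots> \<le> (3 * real n) * ln (real k)"
      using lnk by (intro mult_right_mono nh(3)) simp
    finally have "C \<le> real n * ln (real k)" by simp
    then show "real d \<ge> 1/50000 * (real h * ln (real k)) / (\<epsilon>\<^sup>2 * max 1 (ln (1 / \<epsilon>)))"
      by (intro dim_lower_bound nh(3)) (simp add: C_def)
  qed
qed simp

end
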